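(* For every non-negative integer $n$, $$Q_5(5n+4)\equiv 0 \pmod 5,\qquad Q_7(7n+5)\equiv 0 \pmod 7,\qquad Q_{11}(11n+6)\equiv 0 \pmod{11}.$$
   Context: A partition of a positive integer $m$ is a non-increasing sequence of positive integers (its parts) summing to $m$. For positive integers $k,m$, $Q_k(m)$ denotes the total number of occurrences of the part $k$ among all partitions of $m$ (a partition in which $k$ appears $t$ times contributes $t$). *)

theory Defs
  imports Main "HOL-Library.Multiset"
begin

text \<open>A partition of m is represented as a multiset of positive integers (its parts)
  summing to m; this is equivalent to a non-increasing sequence of parts.\<close>
definition partitions :: "nat \<Rightarrow> nat multiset set" where
  "partitions m = {p. (\<forall>x \<in># p. 0 < x) \<and> sum_mset p = m}"

definition Q :: "nat \<Rightarrow> nat \<Rightarrow> nat" where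
  "Q k m = (\<Sum>p \<in> partitions m. count p k)"

end

theory Submission
  imports Defs "HOL-Computational_Algebra.Formal_Power_Series"
    "HOL-Computational_Algebra.Primes" "HOL-Library.Nat_Bijection"
begin

text \<open>Removing one part \<open>k\<close> gives \<open>Q\<^sub>k(m + k) = Q\<^sub>k(m) + p(m)\<close>, so the claim is equivalent to Ramanujan's
  congruences for the partition function. Let \<open>E\<close> be the product of all \<open>1 - q\<^sup>i\<close>, so that
  \<open>1/E\<close> generates \<open>p(n)\<close>, and let \<open>\<ell>\<close> be 5, 7 or 11. Since \<open>(f\<^sup>\<ell>)' = \<ell> f\<^sup>\<ell>\<^sup>-\<^sup>1 f'\<close>, modulo \<open>\<ell>\<close> only
  exponents divisible by \<open>\<ell>\<close> occur in \<open>f\<^sup>\<ell>\<close>, so in \<open>1/E\<close> one may multiply by powers of \<open>E\<^sup>\<ell>\<close>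
  without mixing residue classes of exponents. By Jacobi's identity
  \<open>E\<^sup>3 = \<Sum> (-1)\<^sup>k (2k+1) q\<^sup>k\<^sup>(\<^sup>k\<^sup>+\<^sup>1\<^sup>)\<^sup>/\<^sup>2\<close>, few residue classes occur in \<open>E\<^sup>3\<close>, and the wanted one does not
  occur in \<open>E\<^sup>9 = (E\<^sup>3)\<^sup>3\<close> modulo 5 and in \<open>E\<^sup>6 = (E\<^sup>3)\<^sup>2\<close> modulo 7.
  Modulo 11 one uses \<open>E\<^sup>2\<^sup>1 = (E\<^sup>3)\<^sup>7\<close>. Here Euler's pentagonal number theorem and
  \<open>(E\<^sup>3)\<^sup>4 = E E\<^sup>1\<^sup>1\<close> show that five residue classes vanish in \<open>(E\<^sup>3)\<^sup>4\<close>. This gives five quartic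
  relations between the nonzero residue class parts of \<open>E\<^sup>3\<close>, and the part of
  \<open>(E\<^sup>3)\<^sup>7\<close> in class 6 lies in the ideal which they generate modulo 11.\<close>

unbundle fps_syntax

section \<open>Finite forms of the identities of Euler and Jacobi\<close>

text \<open>For \<open>m <= n\<close> this is (q;q)_n / (q;q)_m, written without division so that it
  makes sense in every commutative ring.\<close>

definition qprod :: "'a::comm_ring_1 \<Rightarrow> nat \<Rightarrow> nat \<Rightarrow> 'a" where
  "qprod q m n = (\<Prod>i=Suc m..n. 1 - q ^ i)"

lemma qprod_same [simp]: "qprod q n n = 1"
  by (simp add: qprod_def)

lemma qprod_Suc_right: "m \<le> n \<Longrightarrow> qprod q m (Suc n) = qprod q m n * (1 - q ^ Suc n)"
  by (simp add: qprod_def)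

lemma qprod_Suc_left: "m < n \<Longrightarrow> qprod q m n = (1 - q ^ Suc m) * qprod q (Suc m) n"
  unfolding qprod_def by (rule prod.atLeast_Suc_atMost) simp

lemma qprod_append: "m \<le> n \<Longrightarrow> n \<le> r \<Longrightarrow> qprod q m n * qprod q n r = qprod q m r"
proof (induction r)
  case (Suc r)
  then show ?case
    by (cases "n = Suc r") (simp_all add: qprod_Suc_right mult.assoc [symmetric])
qed simp

definition euler_term :: "'a::comm_ring_1 \<Rightarrow> nat \<Rightarrow> nat \<Rightarrow> 'a" where
  "euler_term q n k = (-1) ^ k * q ^ (n * k + triangle k) * qprod q k n"

text \<open>The closed form for all \<open>j\<close> makes the induction work; at
  \<open>j = n\<close> its product is empty and a single power of \<open>q\<close> is left.\<close>

lemma sum_euler_term_diff: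
  assumes "j \<le> n"
  shows "(\<Sum>k\<le>j. euler_term q (Suc n) k - euler_term q n k) =
    (-1) ^ Suc j * q ^ (n * Suc j + triangle (Suc j)) * qprod q j n"
  using assms
proof (induction j)
  case 0
  then show ?case
    by (simp add: euler_term_def qprod_Suc_right algebra_simps)
next
  case (Suc j)
  define A where "A = (-1) ^ Suc j * q ^ (n * Suc j + triangle (Suc j)) * qprod q (Suc j) n"
  have IH: "(\<Sum>k\<le>j. euler_term q (Suc n) k - euler_term q n k) = A * (1 - q ^ Suc j)"
    using Suc by (simp add: A_def qprod_Suc_left mult_ac del: power_Suc triangle_Suc)
  have "q ^ (Suc n * Suc j + triangle (Suc j)) = q ^ Suc j * q ^ (n * Suc j + triangle (Suc j))"
    by (simp only: power_add [symmetric]) (simp add: algebra_simps)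
  then have t1: "euler_term q (Suc n) (Suc j) = A * (q ^ Suc j * (1 - q ^ Suc n))"
    using Suc.prems
    by (simp add: euler_term_def A_def qprod_Suc_right mult_ac del: mult_Suc power_Suc triangle_Suc)
  have t2: "euler_term q n (Suc j) = A"
    by (simp add: euler_term_def A_def)
  have t3: "(-1) ^ Suc (Suc j) * q ^ (n * Suc (Suc j) + triangle (Suc (Suc j))) * qprod q (Suc j) n
      = - A * (q ^ Suc j * q ^ Suc n)"
    by (simp add: A_def power_add mult_ac)
  show ?case
    by (simp only: sum.atMost_Suc IH t1 t2 t3) (simp add: algebra_simps)
qed

text \<open>Raising \<open>n\<close> by one adds two monomials, the sum of the differences and the
  new last summand. Their exponents are the pentagonal numbers k(3k-1)/2 and k(3k+1)/2 at k = n +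
  1.\<close>

theorem shanks_identity:
  fixes q :: "'a::comm_ring_1"
  shows "(\<Sum>k\<le>n. euler_term q n k) =
    1 + (\<Sum>k<n. (-1) ^ Suc k * (q ^ (k * Suc k + triangle (Suc k)) + q ^ (Suc k * Suc k + triangle (Suc k))))"
proof (induction n)
  case 0
  then show ?case by (simp add: euler_term_def)
next
  case (Suc n)
  have "(\<Sum>k\<le>Suc n. euler_term q (Suc n) k) =
    (\<Sum>k\<le>n. euler_term q n k) + (\<Sum>k\<le>n. euler_term q (Suc n) k - euler_term q n k)
      + euler_term q (Suc n) (Suc n)"
    by (simp add: sum_subtractf)
  also have "(\<Sum>k\<le>n. euler_term q (Suc n) k - euler_term q n k)
      = (-1) ^ Suc n * q ^ (n * Suc n + triangle (Suc n))"
    by (subst sum_euler_term_diff) (simp_all del: power_Suc triangle_Suc)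
  also have "euler_term q (Suc n) (Suc n) = (-1) ^ Suc n * q ^ (Suc n * Suc n + triangle (Suc n))"
    by (simp add: euler_term_def del: power_Suc triangle_Suc)
  finally show ?case
    by (simp only: Suc.IH sum.lessThan_Suc distrib_left add.assoc)
qed

text \<open>\<open>jcoeff q n k\<close> is the Gaussian binomial coefficient \<open>[2n+1, n-k]\<close>; the recursion is the
  twofold Pascal rule, in which the term \<open>k - 1\<close> for \<open>k = 0\<close> has been replaced
  using the symmetry \<open>[2n+1, n+1] = [2n+1, n]\<close>.\<close>
fun jcoeff :: "'a::comm_ring_1 \<Rightarrow> nat \<Rightarrow> nat \<Rightarrow> 'a" where
  "jcoeff q 0 k = (if k = 0 then 1 else 0)"
| "jcoeff q (Suc n) 0 =
    (1 + q ^ (n + 1) + q ^ (2 * n + 2)) * jcoeff q n 0 + q ^ (n + 2) * jcoeff q n 1"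
| "jcoeff q (Suc n) (Suc k) =
    (1 + q ^ (2 * n + 2)) * jcoeff q n (Suc k) + q ^ (n + k + 3) * jcoeff q n (Suc (Suc k))
      + q ^ (n - k) * jcoeff q n k"

lemma jcoeff_eq_0: "n < k \<Longrightarrow> jcoeff q n k = 0"
  by (induction q n k rule: jcoeff.induct) auto

definition jacobi_term :: "'a::comm_ring_1 \<Rightarrow> nat \<Rightarrow> 'a" where
  "jacobi_term q k = (-1) ^ k * of_nat (2 * k + 1) * q ^ triangle k"

text \<open>Let Y = q^(n+1). Up to the factor (-1)^k q^(triangle k), the terms \<open>k - 1\<close>
  and \<open>k + 1\<close> contribute -(2k-1)Y and -(2k+3)Y to the coefficient of
  \<open>jcoeff q n k\<close>. Their sum -2(2k+1)Y completes 1 + Y^2 to (1-Y)^2. The last two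
  summands are the boundary terms of the cut at \<open>m\<close>.\<close>

lemma sum_jacobi_Suc:
  assumes "m \<le> n"
  shows "(\<Sum>k\<le>m. jacobi_term q k * jcoeff q (Suc n) k) =
    (1 - q ^ (n + 1)) ^ 2 * (\<Sum>k\<le>m. jacobi_term q k * jcoeff q n k)
      + jacobi_term q m * q ^ (n + m + 2) * jcoeff q n (Suc m)
      - jacobi_term q (Suc m) * q ^ (n - m) * jcoeff q n m"
  using assms
proof (induction m)
  case 0
  have "q ^ (2 * n + 2) = q ^ (n + 1) * q ^ (n + 1)" "q ^ (n + 2) = q * q ^ (n + 1)"
    by (simp_all only: power_add [symmetric] power_Suc [symmetric]) (simp_all add: mult_2)
  then show ?case
    unfolding jcoeff.simps by (simp add: jacobi_term_def power2_eq_square algebra_simps)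
next
  case (Suc m)
  define z where "z = q ^ triangle (Suc m) * (-1) ^ m"
  obtain d where d: "n = Suc m + d"
    using Suc.prems le_Suc_ex by blast
  define Y where "Y = q ^ (n + 1)"
  have e: "q ^ (triangle m + (n + m + 2)) = q ^ triangle (Suc m) * Y"
    "q ^ (triangle (Suc m) + (n - m)) = q ^ triangle (Suc m) * q ^ (n - m)"
    "q ^ (triangle (Suc (Suc m)) + (n - Suc m)) = q ^ triangle (Suc m) * Y"
    "q ^ (2 * n + 2) = Y * Y"
  proof -
    have exps: "triangle m + (n + m + 2) = triangle (Suc m) + (n + 1)"
      "triangle (Suc (Suc m)) + (n - Suc m) = triangle (Suc m) + (n + 1)"
      "2 * n + 2 = (n + 1) + (n + 1)"
      by (simp_all add: d)
    show "q ^ (triangle m + (n + m + 2)) = q ^ triangle (Suc m) * Y"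
      "q ^ (triangle (Suc m) + (n - m)) = q ^ triangle (Suc m) * q ^ (n - m)"
      "q ^ (triangle (Suc (Suc m)) + (n - Suc m)) = q ^ triangle (Suc m) * Y"
      "q ^ (2 * n + 2) = Y * Y"
      unfolding exps Y_def power_add by rule+
  qed
  have w: "jacobi_term q (Suc m) = - of_nat (2 * m + 3) * z"
    "jacobi_term q m * q ^ (n + m + 2) = of_nat (2 * m + 1) * z * Y"
    "jacobi_term q (Suc (Suc m)) * q ^ (n - Suc m) = of_nat (2 * m + 5) * z * Y"
    unfolding jacobi_term_def mult.assoc power_add [symmetric] e
    by (simp_all add: z_def algebra_simps del: triangle_Suc)
  have "(\<Sum>k\<le>Suc m. jacobi_term q k * jcoeff q (Suc n) k) =
      (1 - Y) ^ 2 * (\<Sum>k\<le>m. jacobi_term q k * jcoeff q n k)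
      + of_nat (2 * m + 1) * z * Y * jcoeff q n (Suc m)
      + of_nat (2 * m + 3) * z * q ^ (n - m) * jcoeff q n m
      - of_nat (2 * m + 3) * z * ((1 + Y * Y) * jcoeff q n (Suc m)
        + q ^ (n + m + 3) * jcoeff q n (Suc (Suc m)) + q ^ (n - m) * jcoeff q n m)"
    unfolding sum.atMost_Suc Suc.IH [OF Suc_leD [OF Suc.prems]] jcoeff.simps w e
    by (simp add: Y_def algebra_simps)
  also have "\<dots> = (1 - Y) ^ 2 * ((\<Sum>k\<le>m. jacobi_term q k * jcoeff q n k)
        + - of_nat (2 * m + 3) * z * jcoeff q n (Suc m))
      + - of_nat (2 * m + 3) * z * q ^ (n + m + 3) * jcoeff q n (Suc (Suc m))
      - of_nat (2 * m + 5) * z * Y * jcoeff q n (Suc m)"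
    by (simp add: power2_eq_square algebra_simps)
  also have "q ^ (n + m + 3) = q ^ (n + Suc m + 2)"
    by (rule arg_cong) simp
  finally show ?case
    unfolding sum.atMost_Suc w Y_def [symmetric] by simp
qed

theorem finite_jacobi: "(\<Sum>k\<le>n. jacobi_term q k * jcoeff q n k) = qprod q 0 n ^ 2"
proof (induction n)
  case 0
  then show ?case by (simp add: jacobi_term_def)
next
  case (Suc n)
  \<comment> \<open>For \<open>m = n\<close> the first boundary term vanishes and the second cancels
    the summand \<open>k = Suc n\<close>.\<close>
  have "(\<Sum>k\<le>Suc n. jacobi_term q k * jcoeff q (Suc n) k)
      = (1 - q ^ (n + 1)) ^ 2 * (\<Sum>k\<le>n. jacobi_term q k * jcoeff q n k)"
    using sum_jacobi_Suc [of n n q] by (simp add: jcoeff_eq_0)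
  then show ?case
    by (simp add: Suc.IH qprod_Suc_right power_mult_distrib mult.commute)
qed

text \<open>Identifies \<open>jcoeff\<close> as a Gaussian binomial without division; this shows its
  behaviour for large \<open>n\<close>, which the recursion hides.\<close>

lemma qprod_mult_jcoeff:
  assumes "k \<le> n"
  shows "qprod q 0 (n - k) * qprod q 0 (n + k + 1) * jcoeff q n k = qprod q 0 (2 * n + 1)"
  using assms
proof (induction n arbitrary: k)
  case 0
  then show ?case by simp
next
  case (Suc n)
  let ?P = "qprod q 0 (2 * n + 1)" and ?c = "qprod q 0 (Suc n - k) * qprod q 0 (Suc n + k + 1)"
  have P: "qprod q 0 (2 * Suc n + 1) = ?P * (1 - q ^ (2 * n + 2)) * (1 - q ^ (2 * n + 3))"
    by (simp add: qprod_Suc_right mult.assoc numeral_3_eq_3)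
  \<comment> \<open>Outside the range of the induction hypothesis \<open>jcoeff\<close> is 0,
    matched on the right by a factor 1 - q^0; likewise in \<open>up\<close>.\<close>
  have same: "?c * jcoeff q n k = ?P * (1 - q ^ (Suc n - k)) * (1 - q ^ (n + k + 2))"
  proof (cases "k \<le> n")
    case True
    then show ?thesis
      using Suc.IH [of k, symmetric] by (simp add: Suc_diff_le qprod_Suc_right mult_ac)
  next
    case False
    then show ?thesis using Suc.prems by (simp add: jcoeff_eq_0)
  qed
  have up: "?c * jcoeff q n (Suc k) = ?P * (1 - q ^ (n - k)) * (1 - q ^ (Suc n - k))"
  proof (cases "k < n")
    case True
    then obtain d where d: "n = Suc k + d"
      using less_eq_Suc_le le_Suc_ex by metis
    show ?thesis
      using Suc.IH [of "Suc k", symmetric] by (simp add: d qprod_Suc_right mult_ac)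
  next
    case False
    then show ?thesis using Suc.prems by (simp add: jcoeff_eq_0)
  qed
  show ?case
  proof (cases k)
    case 0
    define x where "x = q ^ (n + 1)"
    have pow: "q ^ (2 * n + 2) = x * x" "q ^ (2 * n + 3) = q * (x * x)" "q ^ (n + 2) = q * x"
      and up': "q * x * (1 - q ^ n) = q * x - x * x"
    proof -
      have "2 * n + 2 = n + 1 + (n + 1)" "2 * n + 3 = Suc (n + 1 + (n + 1))"
        by simp_all
      then show "q ^ (2 * n + 2) = x * x" "q ^ (2 * n + 3) = q * (x * x)"
        by (simp_all only: x_def power_add power_Suc)
    qed (simp_all add: x_def algebra_simps)
    have "?c * jcoeff q (Suc n) k = (1 + x + x * x) * (?c * jcoeff q n k)
        + q * x * (?c * jcoeff q n (Suc k))"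
      by (simp only: 0 jcoeff.simps pow x_def [symmetric]) (simp add: algebra_simps)
    also have "q * x * (?c * jcoeff q n (Suc k)) = ?P * (q * x * (1 - q ^ n)) * (1 - x)"
      unfolding up by (simp add: 0 x_def mult_ac)
    also have "?c * jcoeff q n k = ?P * (1 - x) * (1 - q * x)"
      unfolding same by (simp add: 0 x_def)
    finally show ?thesis
      unfolding P pow up' by (simp add: algebra_simps)
  next
    case (Suc j)
    obtain d where d: "n = j + d"
      using \<open>k \<le> Suc n\<close> Suc le_Suc_ex by auto
    define x y where "x = q ^ (n + k + 1)" and "y = q ^ d"
    have pow: "q ^ (2 * n + 2) = x * y" "q ^ (2 * n + 3) = q * x * y" "q ^ (n + j + 3) = q * x"
      "q ^ (n - j) = y"
    proof -
      have "2 * n + 2 = n + k + 1 + d" "2 * n + 3 = Suc (n + k + 1 + d)"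
        "n + j + 3 = Suc (n + k + 1)" "n - j = d"
        by (simp_all add: d Suc)
      then show "q ^ (2 * n + 2) = x * y" "q ^ (2 * n + 3) = q * x * y" "q ^ (n + j + 3) = q * x"
        "q ^ (n - j) = y"
        by (simp_all only: x_def y_def power_add power_Suc mult.assoc)
    qed
    \<comment> \<open>For \<open>d = 0\<close> truncation spoils q * q^(n-k) = y, but then the
      factor 1 - y is 0.\<close>
    have up': "q * x * (1 - q ^ (n - k)) * (1 - y) = (q * x - x * y) * (1 - y)"
      by (cases d) (simp_all add: y_def d Suc algebra_simps)
    have "?c * jcoeff q (Suc n) k = (1 + x * y) * (?c * jcoeff q n k)
        + q * x * (?c * jcoeff q n (Suc k)) + y * (?c * jcoeff q n j)"
      unfolding Suc jcoeff.simps pow by (simp add: algebra_simps)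
    also have "?c * jcoeff q n j = ?P * (1 - x) * (1 - q * x)"
      using Suc.IH [of j, symmetric] \<open>k \<le> Suc n\<close>
      by (simp add: Suc x_def qprod_Suc_right mult_ac)
    also have "q * x * (?c * jcoeff q n (Suc k)) = ?P * (q * x * (1 - q ^ (n - k)) * (1 - y))"
      unfolding up by (simp add: Suc d y_def mult_ac)
    also have "?c * jcoeff q n k = ?P * (1 - y) * (1 - q * x)"
      unfolding same by (simp add: Suc d x_def y_def)
    finally show ?thesis
      unfolding P pow up' by (simp add: algebra_simps)
  qed
qed

section \<open>Power series\<close>

text \<open>Congruence modulo a power of X takes the place of convergence throughout.\<close>

lemma fps_X_power_dvd_iff: "fps_X ^ n dvd (f :: 'a::comm_ring_1 fps) \<longleftrightarrow> (\<forall>i<n. f $ i = 0)"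
proof
  assume "fps_X ^ n dvd f"
  then show "\<forall>i<n. f $ i = 0"
    by (auto simp: fps_X_power_mult_nth elim!: dvdE)
next
  assume "\<forall>i<n. f $ i = 0"
  then have "f = fps_X ^ n * fps_shift n f"
    by (intro fps_ext) (simp add: fps_X_power_mult_nth)
  then show "fps_X ^ n dvd f" ..
qed

lemma dvd_mult_diff_1:
  fixes d :: "'a::comm_ring_1"
  assumes "d dvd a - 1" "d dvd b - 1"
  shows "d dvd a * b - 1"
proof -
  have "a * b - 1 = a * (b - 1) + (a - 1)"
    by (simp add: algebra_simps)
  then show ?thesis using assms by (simp only: dvd_add dvd_mult)
qed

lemma dvd_diff_power:
  fixes d :: "'a::comm_ring_1"
  assumes "d dvd a - b"
  shows "d dvd a ^ n - b ^ n"
  using assms by (simp add: power_diff_sumr2)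

lemma dvd_diff_mult:
  fixes d :: "'a::comm_ring_1"
  assumes "d dvd a - a'" "d dvd b - b'"
  shows "d dvd a * b - a' * b'"
proof -
  have "a * b - a' * b' = a * (b - b') + (a - a') * b'"
    by (simp add: algebra_simps)
  then show ?thesis using assms by (simp only: dvd_add dvd_mult dvd_mult2)
qed

lemma fps_X_dvd_qprod_diff_1:
  assumes "m \<le> n"
  shows "(fps_X :: 'a::comm_ring_1 fps) ^ Suc m dvd qprod fps_X m n - 1"
  using assms
proof (induction n rule: dec_induct)
  case (step n)
  have "(fps_X :: 'a fps) ^ Suc m dvd fps_X ^ Suc n"
    using step.hyps by (intro le_imp_power_dvd) simp
  then have "(fps_X :: 'a fps) ^ Suc m dvd (1 - fps_X ^ Suc n) - 1"
    by simp
  then show ?case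
    using step unfolding qprod_Suc_right [OF step.hyps(1)] by (intro dvd_mult_diff_1)
qed simp

text \<open>The infinite product, read off diagonally: factors beyond the \<open>n\<close>-th do not
  change coefficient \<open>n\<close>.\<close>

definition euler :: "int fps" where
  "euler = Abs_fps (\<lambda>n. qprod fps_X 0 n $ n)"

lemma euler_nth: "n \<le> N \<Longrightarrow> euler $ n = qprod fps_X 0 N $ n"
proof -
  assume le: "n \<le> N"
  have "qprod fps_X 0 N - qprod fps_X 0 n = qprod fps_X 0 n * (qprod fps_X n N - (1 :: int fps))"
    using qprod_append [of 0 n N "fps_X :: int fps", symmetric] le by (simp add: right_diff_distrib)
  then have "fps_X ^ Suc n dvd qprod fps_X 0 N - (qprod fps_X 0 n :: int fps)"
    using fps_X_dvd_qprod_diff_1 [OF le] by (metis dvd_mult)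
  then show ?thesis
    by (simp add: euler_def fps_X_power_dvd_iff del: power_Suc)
qed

lemma euler_diff_qprod: "fps_X ^ Suc N dvd euler - qprod fps_X 0 N"
  by (auto simp: fps_X_power_dvd_iff euler_nth simp del: power_Suc)

lemma qprod_nth_0 [simp]: "qprod (fps_X :: 'a::comm_ring_1 fps) 0 N $ 0 = 1"
  using fps_X_dvd_qprod_diff_1 [of 0 N] unfolding fps_X_power_dvd_iff by simp

lemma euler_nth_0 [simp]: "euler $ 0 = 1"
  by (simp add: euler_def)

lemma euler_power_nth_0 [simp]: "(euler ^ m) $ 0 = 1"
  by (induction m) simp_all

lemma fps_minus_one_power: "(-1 :: int fps) ^ k = fps_const ((-1) ^ k)"
  by (simp flip: fps_const_power fps_const_neg)

text \<open>In Shanks's identity at q = X a left summand with \<open>k > 0\<close> has order at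
  least n + 1, so at coefficient \<open>n\<close> only the product \<open>k = 0\<close>
  remains.\<close>

theorem euler_pentagonal:
  "euler $ n = (1 + (\<Sum>k<n. (-1) ^ Suc k *
      (fps_X ^ (k * Suc k + triangle (Suc k)) + fps_X ^ (Suc k * Suc k + triangle (Suc k))))) $ n"
proof -
  have "euler_term fps_X n k $ n = (0 :: int)" if "k > 0" for k
  proof -
    have "n < n * k + triangle k"
      using that by (cases k) auto
    then show ?thesis
      by (simp add: euler_term_def fps_minus_one_power mult.assoc fps_X_power_mult_nth)
  qed
  then have "(\<Sum>k\<le>n. euler_term fps_X n k) $ n = (euler_term fps_X n 0 $ n :: int)"
    by (simp add: fps_sum_nth sum.atMost_shift)
  also have "\<dots> = euler $ n"
    by (simp add: euler_term_def euler_def)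
  finally show ?thesis
    unfolding shanks_identity by simp
qed

lemma jacobi_term_fps_nth:
  "jacobi_term (fps_X :: int fps) k $ n = (if n = triangle k then (-1) ^ k * int (2 * k + 1) else 0)"
proof -
  have "jacobi_term (fps_X :: int fps) k = fps_const ((-1) ^ k * int (2 * k + 1)) * fps_X ^ triangle k"
    unfolding jacobi_term_def fps_minus_one_power fps_of_nat [symmetric] by simp
  then show ?thesis
    by (simp del: fps_const_mult)
qed

text \<open>Makes explicit how fast the Gaussian binomial tends to 1/E: after cancelling
  (q;q)_(n-k), only factors 1 - q^i with i > n - k remain.\<close>

lemma fps_X_dvd_jcoeff_diff_1:
  assumes "k \<le> n"
  shows "fps_X ^ Suc (n - k) dvd qprod fps_X 0 (2 * n + 1) * jcoeff (fps_X :: int fps) n k - 1"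
proof -
  let ?q = "fps_X :: int fps"
  have "qprod ?q 0 (n - k) * (qprod ?q 0 (n + k + 1) * jcoeff ?q n k)
      = qprod ?q 0 (n - k) * qprod ?q (n - k) (2 * n + 1)"
    using qprod_mult_jcoeff [OF assms, of ?q] by (simp add: qprod_append mult.assoc)
  moreover have "qprod ?q 0 (n - k) \<noteq> 0"
    using qprod_nth_0 [of "n - k", where 'a = int] by (metis fps_zero_nth zero_neq_one)
  ultimately have eq: "qprod ?q 0 (n + k + 1) * jcoeff ?q n k = qprod ?q (n - k) (2 * n + 1)"
    by simp
  have "qprod ?q 0 (2 * n + 1) = qprod ?q (n + k + 1) (2 * n + 1) * qprod ?q 0 (n + k + 1)"
    using qprod_append [of 0 "n + k + 1" "2 * n + 1" ?q] assms by (simp add: mult.commute)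
  then have "qprod ?q 0 (2 * n + 1) * jcoeff ?q n k
      = qprod ?q (n + k + 1) (2 * n + 1) * qprod ?q (n - k) (2 * n + 1)"
    by (simp only: mult.assoc eq)
  moreover have "?q ^ Suc (n - k) dvd ?q ^ Suc (n + k + 1)"
    by (intro le_imp_power_dvd) simp
  then have "?q ^ Suc (n - k) dvd qprod ?q (n + k + 1) (2 * n + 1) - 1"
    by (rule dvd_trans) (use assms in \<open>intro fps_X_dvd_qprod_diff_1, simp\<close>)
  ultimately show ?thesis
    using fps_X_dvd_qprod_diff_1 [of "n - k" "2 * n + 1", where 'a = int]
    by (simp add: dvd_mult_diff_1 del: power_Suc)
qed

theorem euler_cubed_nth:
  "(euler ^ 3) $ n = (\<Sum>k\<le>n. if n = triangle k then (-1) ^ k * int (2 * k + 1) else 0)"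
proof -
  let ?q = "fps_X :: int fps" and ?c = "\<lambda>k. qprod (fps_X :: int fps) 0 (2 * n + 1) * jcoeff fps_X n k"
  have "?q ^ Suc n dvd euler ^ 2 - qprod ?q 0 n ^ 2"
    by (intro dvd_diff_power euler_diff_qprod)
  moreover have "?q ^ Suc n dvd euler - qprod ?q 0 (2 * n + 1)"
    by (rule dvd_trans [OF _ euler_diff_qprod]) (intro le_imp_power_dvd, simp)
  ultimately have "?q ^ Suc n dvd euler * euler ^ 2 - qprod ?q 0 (2 * n + 1) * qprod ?q 0 n ^ 2"
    by (intro dvd_diff_mult)
  also have "euler * euler ^ 2 = euler ^ 3"
    by (simp add: power3_eq_cube power2_eq_square mult.assoc)
  also have "qprod ?q 0 (2 * n + 1) * qprod ?q 0 n ^ 2 = (\<Sum>k\<le>n. jacobi_term ?q k * ?c k)"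
    by (simp add: finite_jacobi [symmetric] sum_distrib_left mult_ac)
  finally have 1: "?q ^ Suc n dvd euler ^ 3 - (\<Sum>k\<le>n. jacobi_term ?q k * ?c k)" .
  \<comment> \<open>The estimate for \<open>jcoeff\<close> weakens as \<open>k\<close> grows, but
    the factor X^(triangle k) compensates because k <= triangle k.\<close>
  have "?q ^ Suc n dvd jacobi_term ?q k * (?c k - 1)" if "k \<le> n" for k
  proof -
    have "k \<le> triangle k" by (cases k) auto
    then have "?q ^ Suc n dvd ?q ^ triangle k * ?q ^ Suc (n - k)"
      unfolding power_add [symmetric] by (intro le_imp_power_dvd) simp
    also have "\<dots> dvd jacobi_term ?q k * (?c k - 1)"
      using fps_X_dvd_jcoeff_diff_1 [OF that] by (intro mult_dvd_mono) (simp_all add: jacobi_term_def)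
    finally show ?thesis .
  qed
  then have "?q ^ Suc n dvd (\<Sum>k\<le>n. jacobi_term ?q k * (?c k - 1))"
    by (intro dvd_sum) simp
  also have "(\<Sum>k\<le>n. jacobi_term ?q k * (?c k - 1))
      = (\<Sum>k\<le>n. jacobi_term ?q k * ?c k) - (\<Sum>k\<le>n. jacobi_term ?q k)"
    by (simp only: right_diff_distrib sum_subtractf mult_1_right)
  finally have "?q ^ Suc n dvd euler ^ 3 - (\<Sum>k\<le>n. jacobi_term ?q k)"
    using dvd_add [OF 1] by fastforce
  then show ?thesis
    by (simp add: fps_X_power_dvd_iff fps_sum_nth jacobi_term_fps_nth del: power_Suc)
qed

section \<open>Residue classes of exponents\<close>

definition supported_mod :: "nat \<Rightarrow> nat set \<Rightarrow> int fps \<Rightarrow> bool" where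
  "supported_mod p A f \<longleftrightarrow> (\<forall>n. n mod p \<notin> A \<longrightarrow> int p dvd f $ n)"

lemma supported_mod_mono: "supported_mod p A f \<Longrightarrow> A \<subseteq> B \<Longrightarrow> supported_mod p B f"
  by (auto simp: supported_mod_def)

lemma supported_mod_mult:
  assumes "supported_mod p A f" "supported_mod p B g"
  shows "supported_mod p ((\<lambda>(a, b). (a + b) mod p) ` (A \<times> B)) (f * g)"
  unfolding supported_mod_def
proof (intro allI impI)
  fix n
  assume n: "n mod p \<notin> (\<lambda>(a, b). (a + b) mod p) ` (A \<times> B)"
  have "int p dvd f $ i * g $ (n - i)" if "i \<le> n" for i
  proof -
    have "(i mod p + (n - i) mod p) mod p = n mod p"
      using that by (simp add: mod_add_eq)
    then have "i mod p \<notin> A \<or> (n - i) mod p \<notin> B"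
      using n by force
    then show ?thesis
      using assms by (auto simp: supported_mod_def)
  qed
  then show "int p dvd (f * g) $ n"
    unfolding fps_mult_nth by (intro dvd_sum) simp
qed

lemma supported_mod_power_prime:
  assumes "prime p"
  shows "supported_mod p {0} (f ^ p)"
  unfolding supported_mod_def
proof (intro allI impI)
  fix n
  assume n: "n mod p \<notin> {0}"
  then obtain m where m: "n = Suc m" by (cases n) auto
  have "fps_deriv (f ^ p) $ m = int p * (fps_deriv f * f ^ (p - 1)) $ m"
    by (simp add: fps_deriv_power mult.assoc)
  then have "int p dvd int n * (f ^ p) $ n"
    by (simp add: m)
  moreover have "\<not> int p dvd int n"
    using n by (simp add: mod_eq_0_iff_dvd)
  ultimately show "int p dvd (f ^ p) $ n"
    using assms by (simp add: prime_dvd_mult_iff)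
qed

lemma supported_mod_zero_power:
  assumes "supported_mod p {0} f" "p > 0"
  shows "supported_mod p {0} (f ^ m)"
proof (induction m)
  case 0
  then show ?case using assms(2) by (auto simp: supported_mod_def)
next
  case (Suc m)
  then show ?case
    using supported_mod_mult [OF assms(1) Suc] by simp
qed

section \<open>Counting partitions\<close>

text \<open>Guards against default values: \<open>sum\<close> and \<open>card\<close> over an
  infinite set would be 0.\<close>

lemma finite_partitions: "finite (partitions m)"
proof (rule finite_subset)
  show "partitions m \<subseteq> mset ` {xs. set xs \<subseteq> {..m} \<and> length xs \<le> m}"
  proof
    fix p
    assume "p \<in> partitions m"
    then have p: "\<And>x. x \<in># p \<Longrightarrow> 0 < x" "sum_mset p = m"
      by (auto simp: partitions_def)
    obtain xs where xs: "mset xs = p"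
      using ex_mset by blast
    have "length ys \<le> sum_list ys" if "\<forall>x\<in>set ys. 0 < x" for ys :: "nat list"
      using that by (induction ys) (auto simp: Suc_le_eq)
    then have "length xs \<le> m"
      using p xs by (metis set_mset_mset sum_mset_sum_list)
    moreover have "x \<le> m" if "x \<in> set xs" for x
      using member_le_sum_list [OF that] p xs by (simp flip: sum_mset_sum_list)
    ultimately show "p \<in> mset ` {xs. set xs \<subseteq> {..m} \<and> length xs \<le> m}"
      using xs by auto
  qed
  show "finite (mset ` {xs. set xs \<subseteq> {..m} \<and> length xs \<le> m})"
    by (intro finite_imageI finite_lists_length_le) simp
qed

lemma partitions_part_le: "p \<in> partitions m \<Longrightarrow> x \<in># p \<Longrightarrow> x \<le> m"
  by (auto simp: partitions_def dest!: multi_member_split)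

lemma partitions_containing:
  assumes "0 < k"
  shows "{p \<in> partitions (m + k). k \<in># p} = add_mset k ` partitions m"
proof (intro equalityI subsetI)
  fix p
  assume "p \<in> {p \<in> partitions (m + k). k \<in># p}"
  moreover then obtain p' where "p = add_mset k p'"
    by (auto dest: multi_member_split)
  ultimately show "p \<in> add_mset k ` partitions m"
    by (auto simp: partitions_def)
qed (use assms in \<open>auto simp: partitions_def\<close>)

text \<open>Bounding the parts turns the generating function into the inverse of a finite
  product.\<close>

definition bounded_partitions :: "nat \<Rightarrow> nat \<Rightarrow> nat multiset set" where
  "bounded_partitions N m = {p \<in> partitions m. \<forall>x \<in># p. x \<le> N}"

lemma finite_bounded_partitions: "finite (bounded_partitions N m)"
  by (simp add: bounded_partitions_def finite_partitions)

lemma bounded_partitions_0: "bounded_partitions 0 m = (if m = 0 then {{#}} else {})"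
proof -
  have "p = {#}" if "p \<in> bounded_partitions 0 m" for p
    using that unfolding bounded_partitions_def partitions_def
    by (metis (mono_tags, lifting) mem_Collect_eq le_zero_eq less_irrefl multiset_nonemptyE)
  then have "bounded_partitions 0 m \<subseteq> {{#}}"
    by blast
  moreover have "{#} \<in> bounded_partitions 0 m \<longleftrightarrow> m = 0"
    by (auto simp: bounded_partitions_def partitions_def)
  ultimately show ?thesis
    by auto
qed

lemma bounded_partitions_eq: "m \<le> N \<Longrightarrow> bounded_partitions N m = partitions m"
  using partitions_part_le by (fastforce simp: bounded_partitions_def)

text \<open>Split by whether \<open>Suc N\<close> occurs; if it does, remove one copy. For
  generating functions this is multiplication by 1 - X^(N+1).\<close>

lemma card_bounded_partitions_Suc:
  "card (bounded_partitions (Suc N) m) = card (bounded_partitions N m) +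
    (if Suc N \<le> m then card (bounded_partitions (Suc N) (m - Suc N)) else 0)"
proof -
  let ?B = "{p \<in> bounded_partitions (Suc N) m. Suc N \<in># p}"
  have "bounded_partitions (Suc N) m = bounded_partitions N m \<union> ?B"
    by (auto simp: bounded_partitions_def le_Suc_eq)
  moreover have "bounded_partitions N m \<inter> ?B = {}"
    by (auto simp: bounded_partitions_def)
  ultimately have "card (bounded_partitions (Suc N) m) = card (bounded_partitions N m) + card ?B"
    by (metis card_Un_disjoint finite_Un finite_bounded_partitions)
  moreover have "card ?B = card (bounded_partitions (Suc N) (m - Suc N))" if "Suc N \<le> m"
  proof -
    have "?B = {p \<in> {p \<in> partitions m. Suc N \<in># p}. \<forall>x \<in># p. x \<le> Suc N}"
      by (auto simp: bounded_partitions_def)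
    also have "{p \<in> partitions m. Suc N \<in># p} = add_mset (Suc N) ` partitions (m - Suc N)"
      using partitions_containing [of "Suc N" "m - Suc N"] that by simp
    also have "{p \<in> \<dots>. \<forall>x \<in># p. x \<le> Suc N} = add_mset (Suc N) ` bounded_partitions (Suc N) (m - Suc N)"
      unfolding bounded_partitions_def by auto
    finally have "?B = add_mset (Suc N) ` bounded_partitions (Suc N) (m - Suc N)" .
    then have "card ?B = card (add_mset (Suc N) ` bounded_partitions (Suc N) (m - Suc N))"
      by (rule arg_cong)
    then show ?thesis
      by (simp add: card_image inj_on_def)
  qed
  moreover have "card ?B = 0" if "\<not> Suc N \<le> m"
  proof -
    have "?B = {}"
      using that partitions_part_le by (fastforce simp: bounded_partitions_def)
    then show ?thesis by (simp only: card.empty)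
  qed
  ultimately show ?thesis by simp
qed

definition bounded_partition_fps :: "nat \<Rightarrow> int fps" where
  "bounded_partition_fps N = Abs_fps (\<lambda>m. int (card (bounded_partitions N m)))"

lemma bounded_partition_fps_mult_qprod: "bounded_partition_fps N * qprod fps_X 0 N = 1"
proof (induction N)
  case 0
  then show ?case
    by (auto intro!: fps_ext simp: bounded_partition_fps_def bounded_partitions_0)
next
  case (Suc N)
  have "bounded_partition_fps (Suc N) * (1 - fps_X ^ Suc N) = bounded_partition_fps N"
    by (rule fps_ext)
      (simp add: bounded_partition_fps_def card_bounded_partitions_Suc right_diff_distrib
        fps_X_power_mult_right_nth del: power_Suc)
  moreover have "bounded_partition_fps (Suc N) * qprod fps_X 0 (Suc N)
      = bounded_partition_fps (Suc N) * (1 - fps_X ^ Suc N) * qprod fps_X 0 N"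
    by (simp only: qprod_Suc_right [OF le0] mult_ac)
  ultimately show ?case
    using Suc by simp
qed

definition partition_fps :: "int fps" where
  "partition_fps = Abs_fps (\<lambda>m. int (card (partitions m)))"

theorem partition_fps_mult_euler: "partition_fps * euler = 1"
proof (rule fps_ext)
  fix n
  \<comment> \<open>Coefficient \<open>n\<close> involves only partitions of numbers up to
    \<open>n\<close> and factors up to \<open>n\<close>, so the bound \<open>n\<close>
    suffices.\<close>
  have "(partition_fps * euler) $ n = (bounded_partition_fps n * qprod fps_X 0 n) $ n"
    unfolding fps_mult_nth
    by (intro sum.cong)
      (simp_all add: partition_fps_def bounded_partition_fps_def bounded_partitions_eq euler_nth [of _ n])
  then show "(partition_fps * euler) $ n = 1 $ n"
    by (simp add: bounded_partition_fps_mult_qprod)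
qed

text \<open>The denominator \<open>euler ^ (p * a)\<close> is modulo \<open>p\<close> a power series in the \<open>p\<close>-th power
  of the variable, so it does not mix the residue classes of exponents.\<close>
lemma dvd_card_partitions:
  assumes "prime p" and r: "r < p" "r \<notin> A"
    and G: "partition_fps * euler ^ (p * a) = G" "supported_mod p A G"
  shows "p dvd card (partitions (p * n + r))"
proof -
  define U where "U = euler ^ (p * a)"
  have U: "supported_mod p {0} U" "U $ 0 = 1"
    using \<open>prime p\<close> unfolding U_def power_mult
    by (intro supported_mod_zero_power supported_mod_power_prime prime_gt_0_nat) (simp_all flip: power_mult)
  \<comment> \<open>As \<open>U $ 0 = 1\<close>, coefficient \<open>m\<close> of \<open>G\<close> is
    that of \<open>partition_fps\<close> plus terms with \<open>i < m\<close>. Each of these is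
    divisible by \<open>p\<close>, by induction if \<open>p\<close> divides \<open>m - i\<close> and
    through \<open>U\<close> otherwise.\<close>
  have "int p dvd partition_fps $ m" if "m mod p = r" for m
    using that
  proof (induction m rule: less_induct)
    case (less m)
    have "int p dvd G $ m"
      using G(2) less.prems r by (simp add: supported_mod_def)
    also have "G $ m = (\<Sum>i=0..<m. partition_fps $ i * U $ (m - i)) + partition_fps $ m"
      by (simp add: G(1) [symmetric] U_def [symmetric] fps_mult_nth U(2) atLeastLessThanSuc_atLeastAtMost [symmetric])
    finally have "int p dvd (\<Sum>i=0..<m. partition_fps $ i * U $ (m - i)) + partition_fps $ m" .
    moreover have "int p dvd (\<Sum>i=0..<m. partition_fps $ i * U $ (m - i))"
    proof (intro dvd_sum)
      fix i
      assume i: "i \<in> {0..<m}"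
      show "int p dvd partition_fps $ i * U $ (m - i)"
      proof (cases "(m - i) mod p = 0")
        case True
        then have "i mod p = m mod p"
          using i by (metis atLeastLessThan_iff less_imp_le mod_eq_iff_dvd_symdiff_nat
              mod_eq_0_iff_dvd mod_eq_dvd_iff_nat)
        then show ?thesis
          using less i by simp
      next
        case False
        then show ?thesis
          using U(1) by (simp add: supported_mod_def)
      qed
    qed
    ultimately show ?case
      by (simp only: dvd_add_right_iff)
  qed
  from this [of "p * n + r"] show ?thesis
    using r by (simp add: partition_fps_def)
qed

section \<open>From partition numbers to \<open>Q\<close>\<close>

lemma Q_less: "m < k \<Longrightarrow> Q k m = 0"
  unfolding Q_def
  by (intro sum.neutral) (auto simp: count_eq_zero_iff dest: partitions_part_le)

lemma Q_add:
  assumes "0 < k"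
  shows "Q k (m + k) = Q k m + card (partitions m)"
proof -
  have "Q k (m + k) = (\<Sum>p\<in>{p \<in> partitions (m + k). k \<in># p}. count p k)"
    unfolding Q_def
    by (rule sum.mono_neutral_right) (auto simp: finite_partitions not_in_iff)
  also have "\<dots> = (\<Sum>p\<in>partitions m. Suc (count p k))"
    by (simp add: partitions_containing [OF assms] sum.reindex inj_on_def)
  also have "\<dots> = Q k m + card (partitions m)"
    unfolding Suc_eq_plus1 sum.distrib Q_def by simp
  finally show ?thesis .
qed

text \<open>\<open>Q_add\<close> is summed along the progression, which starts at 0 because a part
  \<open>k\<close> does not fit into \<open>r < k\<close>.\<close>

lemma dvd_Q:
  assumes "r < k" "\<And>n. k dvd card (partitions (k * n + r))"
  shows "k dvd Q k (k * n + r)"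
proof (induction n)
  case 0
  then show ?case using assms(1) by (simp add: Q_less)
next
  case (Suc n)
  have "Q k (k * Suc n + r) = Q k (k * n + r) + card (partitions (k * n + r))"
    using Q_add [of k "k * n + r"] assms(1) by (simp add: add_ac)
  then show ?case
    using Suc assms(2) by simp
qed

lemma partition_fps_mult_power: "partition_fps * euler ^ Suc m = euler ^ m"
  using partition_fps_mult_euler by (simp add: mult.assoc [symmetric])

section \<open>Residue classes of the exponents in E and E^3\<close>

lemma triangle_add: "triangle (a + b) = triangle a + a * b + triangle b"
  by (induction b) auto

text \<open>For odd \<open>p\<close> the number (p+1)/2 is an integer, so \<open>p\<close> divides
  \<open>triangle p\<close>.\<close>

lemma triangle_mod:
  assumes "odd p"
  shows "triangle k mod p = triangle (k mod p) mod p"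
proof -
  obtain s where s: "p = 2 * s + 1"
    using assms by (elim oddE)
  have "p * Suc p = p * (s + 1) * 2"
    by (simp add: s)
  then have p: "p dvd triangle p"
    by (simp add: triangle_def)
  have "p dvd triangle (p * j)" for j
  proof (induction j)
    case (Suc j)
    have "triangle (p * Suc j) = triangle p + p * (p * j) + triangle (p * j)"
      by (simp add: triangle_add)
    then show ?case using p Suc by simp
  qed simp
  then obtain c where c: "triangle (p * (k div p)) = p * c"
    unfolding dvd_def by blast
  have "triangle k = triangle (p * (k div p) + k mod p)"
    by simp
  also have "\<dots> = p * (c + k div p * (k mod p)) + triangle (k mod p)"
    unfolding triangle_add c by (simp add: algebra_simps)
  finally show ?thesis
    by simp
qed

text \<open>Exponent and coefficient depend modulo \<open>p\<close> only on \<open>k mod p\<close>,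
  up to sign, so finitely many cases decide. If \<open>p\<close> divides 2r+1, the coefficient
  vanishes and \<open>r\<close> puts no demand on \<open>A\<close>.\<close>

lemma supported_mod_euler_cubed:
  assumes "odd p" and A: "\<forall>r\<in>{..<p}. triangle r mod p \<in> A \<or> p dvd 2 * r + 1"
  shows "supported_mod p A (euler ^ 3)"
  unfolding supported_mod_def euler_cubed_nth
proof (intro allI impI dvd_sum)
  fix n k
  assume n: "n mod p \<notin> A"
  have "p dvd 2 * k + 1" if "n = triangle k"
  proof -
    have "p dvd 2 * (k mod p) + 1"
      using n A \<open>odd p\<close> that triangle_mod [OF \<open>odd p\<close>, of k] by (auto simp: odd_pos)
    moreover have "(2 * k + 1) mod p = (2 * (k mod p) + 1) mod p"
      by (intro mod_add_cong mod_mult_cong) simp_all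
    ultimately show ?thesis
      by (simp add: dvd_eq_mod_eq_0)
  qed
  then have "n = triangle k \<Longrightarrow> int p dvd int (2 * k + 1)"
    by (simp only: int_dvd_int_iff)
  then show "int p dvd (if n = triangle k then (-1) ^ k * int (2 * k + 1) else 0)"
    by simp
qed

text \<open>The pentagonal exponents are also periodic modulo \<open>p\<close>;
  \<open>0 \<in> A\<close> accounts for the constant term 1.\<close>

lemma supported_mod_euler:
  assumes "odd p" "0 \<in> A"
    and A: "\<forall>r\<in>{..<p}. (r * Suc r + triangle (Suc r)) mod p \<in> A \<and> (Suc r * Suc r + triangle (Suc r)) mod p \<in> A"
  shows "supported_mod p A euler"
  unfolding supported_mod_def
proof (intro allI impI)
  fix n
  assume n: "n mod p \<notin> A"
  have "n \<noteq> k * Suc k + triangle (Suc k) \<and> n \<noteq> Suc k * Suc k + triangle (Suc k)" for k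
  proof -
    have "triangle (Suc k) mod p = triangle (Suc (k mod p)) mod p"
      unfolding triangle_Suc using triangle_mod [OF \<open>odd p\<close>, of k]
      by (intro mod_add_cong) (simp_all add: mod_simps)
    then have "(k * Suc k + triangle (Suc k)) mod p = (k mod p * Suc (k mod p) + triangle (Suc (k mod p))) mod p"
      "(Suc k * Suc k + triangle (Suc k)) mod p = (Suc (k mod p) * Suc (k mod p) + triangle (Suc (k mod p))) mod p"
      by (auto intro!: mod_add_cong mod_mult_cong simp: mod_simps simp del: triangle_Suc mult_Suc mult_Suc_right)
    moreover have "k mod p \<in> {..<p}"
      using \<open>odd p\<close> by (simp add: odd_pos)
    ultimately show ?thesis
      using A n by metis
  qed
  moreover have "n \<noteq> 0"
    using n \<open>0 \<in> A\<close> by (metis mod_0)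
  ultimately have "euler $ n = 0"
    unfolding euler_pentagonal
    by (simp add: fps_sum_nth fps_minus_one_power fps_X_power_nth del: power_Suc triangle_Suc mult_Suc mult_Suc_right)
  then show "int p dvd euler $ n"
    by simp
qed

text \<open>Here and for 7 and 11, the case 2r + 1 = p removes one class: triangle 2 = 3 modulo 5,
  triangle 3 = 6 modulo 7, triangle 5 = 15 = 4 modulo 11.\<close>

lemma supported_mod_5: "supported_mod 5 {0, 1} (euler ^ 3)"
  by (rule supported_mod_euler_cubed) (simp_all add: lessThan_nat_numeral triangle_def)

lemma supported_mod_7: "supported_mod 7 {0, 1, 3} (euler ^ 3)"
  by (rule supported_mod_euler_cubed) (simp_all add: lessThan_nat_numeral triangle_def)

lemma supported_mod_11: "supported_mod 11 {0, 1, 3, 6, 10} (euler ^ 3)"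
  by (rule supported_mod_euler_cubed) (simp_all add: lessThan_nat_numeral triangle_def)

text \<open>The missing classes 3, 6, 8, 9, 10 yield the five quartic relations.\<close>

lemma supported_mod_11_euler: "supported_mod 11 {0, 1, 2, 4, 5, 7} euler"
  by (rule supported_mod_euler) (simp_all add: lessThan_nat_numeral triangle_def)

section \<open>The congruences modulo 5 and 7\<close>

theorem ramanujan_5: "5 dvd card (partitions (5 * n + 4))"
proof -
  have "euler ^ 9 = euler ^ 3 * (euler ^ 3 * euler ^ 3)"
    unfolding power_add [symmetric] by simp
  then have "partition_fps * euler ^ (5 * 2) = euler ^ 3 * (euler ^ 3 * euler ^ 3)"
    using partition_fps_mult_power [of 9] by simp
  \<comment> \<open>Three summands from {0, 1} never add up to 4 modulo 5.\<close>
  moreover have "supported_mod 5 {0, 1, 2, 3} (euler ^ 3 * (euler ^ 3 * euler ^ 3))"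
    by (rule supported_mod_mono [OF supported_mod_mult [OF supported_mod_5
          supported_mod_mult [OF supported_mod_5 supported_mod_5]]]) auto
  ultimately show ?thesis
    by (rule dvd_card_partitions [rotated 3]) simp_all
qed

theorem ramanujan_7: "7 dvd card (partitions (7 * n + 5))"
proof -
  have "euler ^ 6 = euler ^ 3 * euler ^ 3"
    unfolding power_add [symmetric] by simp
  then have "partition_fps * euler ^ (7 * 1) = euler ^ 3 * euler ^ 3"
    using partition_fps_mult_power [of 6] by simp
  \<comment> \<open>Two summands from {0, 1, 3} never add up to 5 modulo 7.\<close>
  moreover have "supported_mod 7 {0, 1, 2, 3, 4, 6} (euler ^ 3 * euler ^ 3)"
    by (rule supported_mod_mono [OF supported_mod_mult [OF supported_mod_7 supported_mod_7]]) auto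
  ultimately show ?thesis
    by (rule dvd_card_partitions [rotated 3]) simp_all
qed

section \<open>The congruence modulo 11\<close>

definition residue_part :: "nat \<Rightarrow> nat \<Rightarrow> int fps \<Rightarrow> int fps" where
  "residue_part p c f = Abs_fps (\<lambda>n. if n mod p = c then f $ n else 0)"

lemma residue_part_nth: "residue_part p c f $ n = (if n mod p = c then f $ n else 0)"
  by (simp add: residue_part_def)

lemma residue_part_add: "residue_part p c (f + g) = residue_part p c f + residue_part p c g"
  by (rule fps_ext) (simp add: residue_part_nth)

lemma residue_part_residue_part:
  "residue_part p c (residue_part p d f) = (if c = d then residue_part p c f else 0)"
  by (rule fps_ext) (simp add: residue_part_nth)

text \<open>Adding \<open>p\<close> first keeps the subtraction of natural numbers from
  truncating.\<close>

lemma mod_add_eq_iff_nat: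
  fixes i j c p :: nat
  assumes "c < p"
  shows "(i + j) mod p = c \<longleftrightarrow> j mod p = (c + p - i mod p) mod p"
proof -
  have red: "x mod p = (if x < p then x else x - p)" if "x < 2 * p" for x
    using that by (auto simp: le_mod_geq)
  define s t where "s = i mod p" and "t = j mod p"
  have st: "s < p" "t < p"
    using assms by (simp_all add: s_def t_def)
  have "(i + j) mod p = (s + t) mod p"
    by (simp add: s_def t_def mod_simps)
  also have "\<dots> = c \<longleftrightarrow> t = (c + p - s) mod p"
    using assms st red [of "s + t"] red [of "c + p - s"] by auto
  finally show ?thesis
    by (simp add: s_def t_def)
qed

text \<open>Residue classes grade the ring of power series by Z/p; the second index is c -
  a.\<close>

lemma residue_part_mult:
  assumes "c < p"
  shows "residue_part p c (f * g) =
    (\<Sum>a<p. residue_part p a f * residue_part p ((c + p - a) mod p) g)"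
proof (rule fps_ext)
  fix n
  have "(\<Sum>a<p. residue_part p a f * residue_part p ((c + p - a) mod p) g) $ n =
      (\<Sum>i=0..n. \<Sum>a<p. if a = i mod p then f $ i * residue_part p ((c + p - a) mod p) g $ (n - i) else 0)"
    unfolding fps_sum_nth fps_mult_nth
    by (subst sum.swap) (intro sum.cong refl, simp add: residue_part_nth)
  also have "\<dots> = (\<Sum>i=0..n. f $ i * residue_part p ((c + p - i mod p) mod p) g $ (n - i))"
    using assms by (intro sum.cong refl) simp
  also have "\<dots> = (\<Sum>i=0..n. if n mod p = c then f $ i * g $ (n - i) else 0)"
  proof (intro sum.cong refl)
    fix i
    assume "i \<in> {0..n}"
    then show "f $ i * residue_part p ((c + p - i mod p) mod p) g $ (n - i)
        = (if n mod p = c then f $ i * g $ (n - i) else 0)"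
      using mod_add_eq_iff_nat [OF assms, of i "n - i"] by (simp add: residue_part_nth)
  qed
  also have "\<dots> = residue_part p c (f * g) $ n"
    by (simp add: residue_part_nth fps_mult_nth)
  finally show "residue_part p c (f * g) $ n =
      (\<Sum>a<p. residue_part p a f * residue_part p ((c + p - a) mod p) g) $ n" ..
qed

lemma of_nat_dvd_fps_iff: "of_nat m dvd (f :: int fps) \<longleftrightarrow> (\<forall>n. int m dvd f $ n)"
proof
  assume "of_nat m dvd f"
  then show "\<forall>n. int m dvd f $ n"
    by (auto simp flip: fps_of_nat elim!: dvdE)
next
  assume dvd: "\<forall>n. int m dvd f $ n"
  have "f = of_nat m * Abs_fps (\<lambda>n. f $ n div int m)"
    by (rule fps_ext) (use dvd in \<open>simp flip: fps_of_nat\<close>)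
  then show "of_nat m dvd f" ..
qed

lemma of_nat_dvd_residue_part_iff:
  "of_nat p dvd residue_part p c f \<longleftrightarrow> supported_mod p (- {c}) f"
  by (auto simp: of_nat_dvd_fps_iff supported_mod_def residue_part_nth)

lemma supported_mod_cong:
  assumes "of_nat p dvd f - g" "supported_mod p A g"
  shows "supported_mod p A f"
  unfolding supported_mod_def
proof (intro allI impI)
  fix n
  assume "n mod p \<notin> A"
  moreover have "int p dvd f $ n - g $ n"
    using assms(1) by (simp add: of_nat_dvd_fps_iff)
  ultimately show "int p dvd f $ n"
    using assms(2) by (metis supported_mod_def dvd_diff_left_iff)
qed

text \<open>The variables \<open>v, w, x, y, z\<close> stand for the parts of \<open>E\<^sup>3\<close> in the classes 0, 3, 1, 6, 10. In this
  order \<open>8c + 1\<close> runs through 1, 3, 9, 5, 4, the powers of 3 modulo 11, which explains the cyclic symmetry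
  below. The polynomials \<open>cofactor\<close> and \<open>remainder\<close> were found by solving the ideal membership problem
  over the field with 11 elements.\<close>

definition quartic :: "'a::comm_ring_1 \<Rightarrow> 'a \<Rightarrow> 'a \<Rightarrow> 'a \<Rightarrow> 'a \<Rightarrow> 'a" where
  "quartic v w x y z = 4 * v^3 * w + 4 * v * x^3 + 24 * v * w * x * z + 6 * x^2 * y^2
    + 12 * w * y^2 * z + 4 * y * z^3"

definition cofactor :: "'a::comm_ring_1 \<Rightarrow> 'a \<Rightarrow> 'a \<Rightarrow> 'a \<Rightarrow> 'a \<Rightarrow> 'a" where
  "cofactor v w x y z = 4 * v^2 * w - x^3 - w * x * z"

definition remainder :: "'a::comm_ring_1 \<Rightarrow> 'a \<Rightarrow> 'a \<Rightarrow> 'a \<Rightarrow> 'a \<Rightarrow> 'a" where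
  "remainder v w x y z = v^6 * y + v^5 * w^2 + 22 * v^4 * x * y * z + 30 * v^3 * w^2 * x * z
    + 12 * v^3 * w * x^3 + 54 * v^2 * w^2 * y^2 * z"

text \<open>A computation over the integers in the grading by Z/11. In the weights 8c + 1, seven
  parts multiply into class 6 iff their weights add up to 8 * 6 + 7 = 55, that is 0 modulo 11.
  Tripling all weights preserves this, hence the cyclic symmetry of the last formula.\<close>

lemma
  fixes v w x y z :: "int fps"
  defines "f \<equiv> v + w + x + y + z"
  assumes parts: "\<And>c. residue_part 11 c v = (if c = 0 then v else 0)"
    "\<And>c. residue_part 11 c w = (if c = 3 then w else 0)"
    "\<And>c. residue_part 11 c x = (if c = 1 then x else 0)"
    "\<And>c. residue_part 11 c y = (if c = 6 then y else 0)"
    "\<And>c. residue_part 11 c z = (if c = 10 then z else 0)"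
  shows residue_part_power4: "residue_part 11 3 (f ^ 4) = quartic v w x y z"
    "residue_part 11 10 (f ^ 4) = quartic w x y z v"
    "residue_part 11 9 (f ^ 4) = quartic x y z v w"
    "residue_part 11 6 (f ^ 4) = quartic y z v w x"
    "residue_part 11 8 (f ^ 4) = quartic z v w x y"
   and residue_part_power7: "residue_part 11 6 (f ^ 7) =
      quartic v w x y z * cofactor v w x y z + quartic w x y z v * cofactor w x y z v
      + quartic x y z v w * cofactor x y z v w + quartic y z v w x * cofactor y z v w x
      + quartic z v w x y * cofactor z v w x y
      + 11 * (remainder v w x y z + remainder w x y z v + remainder x y z v w
        + remainder y z v w x + remainder z v w x y)"
proof -
  have power4: "f ^ 4 = (f * f) * (f * f)" and power7: "f ^ 7 = (f * f) * (f * f) * (f * (f * f))"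
    by (simp_all add: eval_nat_numeral mult_ac)
  have f: "residue_part 11 0 f = v" "residue_part 11 3 f = w" "residue_part 11 (Suc 0) f = x"
    "residue_part 11 6 f = y" "residue_part 11 10 f = z" "residue_part 11 2 f = 0"
    "residue_part 11 4 f = 0" "residue_part 11 5 f = 0" "residue_part 11 7 f = 0"
    "residue_part 11 8 f = 0" "residue_part 11 9 f = 0"
    by (simp_all add: f_def residue_part_add parts)
  have f2: "residue_part 11 0 (f * f) = v\<^sup>2 + 2 * x * z"
    "residue_part 11 (Suc 0) (f * f) = 2 * v * x + y\<^sup>2"
    "residue_part 11 2 (f * f) = x\<^sup>2 + 2 * w * z"
    "residue_part 11 3 (f * f) = 2 * v * w"
    "residue_part 11 4 (f * f) = 2 * x * w"
    "residue_part 11 5 (f * f) = 2 * y * z"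
    "residue_part 11 6 (f * f) = 2 * v * y + w\<^sup>2"
    "residue_part 11 7 (f * f) = 2 * x * y"
    "residue_part 11 8 (f * f) = 0"
    "residue_part 11 9 (f * f) = 2 * w * y + z\<^sup>2"
    "residue_part 11 10 (f * f) = 2 * v * z"
    by (simp_all add: residue_part_mult lessThan_nat_numeral f power2_eq_square algebra_simps)
  show "residue_part 11 3 (f ^ 4) = quartic v w x y z"
    "residue_part 11 10 (f ^ 4) = quartic w x y z v"
    "residue_part 11 9 (f ^ 4) = quartic x y z v w"
    "residue_part 11 6 (f ^ 4) = quartic y z v w x"
    "residue_part 11 8 (f ^ 4) = quartic z v w x y"
    unfolding power4 quartic_def
    by (simp_all add: residue_part_mult [of _ _ "f * f" "f * f"] lessThan_nat_numeral f2) algebra+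
  show "residue_part 11 6 (f ^ 7) =
      quartic v w x y z * cofactor v w x y z + quartic w x y z v * cofactor w x y z v
      + quartic x y z v w * cofactor x y z v w + quartic y z v w x * cofactor y z v w x
      + quartic z v w x y * cofactor z v w x y
      + 11 * (remainder v w x y z + remainder w x y z v + remainder x y z v w
        + remainder y z v w x + remainder z v w x y)"
    unfolding power7
    by (simp add: residue_part_mult [of _ _ "f * f * (f * f)" "f * (f * f)"]
        residue_part_mult [of _ _ "f * f" "f * f"] residue_part_mult [of _ _ f "f * f"]
        lessThan_nat_numeral f
        f2 f2(3) [unfolded numeral_2_eq_2] quartic_def cofactor_def remainder_def) algebra
qed

theorem ramanujan_11: "11 dvd card (partitions (11 * n + 6))"
proof -
  define J where "J = euler ^ 3"
  define v w x y z where defs: "v = residue_part 11 0 J" "w = residue_part 11 3 J"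
    "x = residue_part 11 1 J" "y = residue_part 11 6 J" "z = residue_part 11 10 J"
  \<comment> \<open>Agrees with \<open>J\<close> only modulo 11, but its parts outside the five
    classes are exactly 0, as the computation requires.\<close>
  define f where "f = v + w + x + y + z"
  have parts: "\<And>c. residue_part 11 c v = (if c = 0 then v else 0)"
    "\<And>c. residue_part 11 c w = (if c = 3 then w else 0)"
    "\<And>c. residue_part 11 c x = (if c = 1 then x else 0)"
    "\<And>c. residue_part 11 c y = (if c = 6 then y else 0)"
    "\<And>c. residue_part 11 c z = (if c = 10 then z else 0)"
    by (simp_all add: defs residue_part_residue_part)
  have J: "of_nat 11 dvd J - f"
    using supported_mod_11 unfolding of_nat_dvd_fps_iff
    by (auto simp: f_def defs residue_part_nth J_def supported_mod_def)
  then have f: "of_nat 11 dvd f ^ k - J ^ k" for k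
    using dvd_minus_iff [of "of_nat 11" "J - f"] by (intro dvd_diff_power) simp
  have "J ^ 4 = euler * euler ^ 11"
    by (simp add: J_def flip: power_mult power_Suc)
  moreover have "supported_mod 11 {0, 1, 2, 4, 5, 7} (euler * euler ^ 11)"
    by (rule supported_mod_mono [OF supported_mod_mult [OF supported_mod_11_euler
          supported_mod_power_prime]]) auto
  ultimately have "supported_mod 11 {0, 1, 2, 4, 5, 7} (f ^ 4)"
    using f supported_mod_cong by metis
  then have "of_nat 11 dvd residue_part 11 c (f ^ 4)" if "c \<notin> {0, 1, 2, 4, 5, 7}" for c
    unfolding of_nat_dvd_residue_part_iff by (rule supported_mod_mono) (use that in auto)
  from this [of 3] this [of 10] this [of 9] this [of 6] this [of 8]
  have quartics: "11 dvd quartic v w x y z" "11 dvd quartic w x y z v" "11 dvd quartic x y z v w"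
    "11 dvd quartic y z v w x" "11 dvd quartic z v w x y"
    unfolding f_def residue_part_power4 [OF parts] by simp_all
  have "of_nat 11 dvd residue_part 11 6 (f ^ 7)"
    unfolding f_def residue_part_power7 [OF parts]
    by (intro dvd_add dvd_mult2) (simp_all add: quartics)
  moreover have "of_nat 11 dvd J ^ 7 - f ^ 7"
    using J by (rule dvd_diff_power)
  ultimately have "supported_mod 11 (- {6}) (J ^ 7)"
    unfolding of_nat_dvd_residue_part_iff by (rule supported_mod_cong [rotated])
  \<comment> \<open>The exponents fit because 3 * 7 = 2 * 11 - 1.\<close>
  moreover have "partition_fps * euler ^ (11 * 2) = J ^ 7"
    using partition_fps_mult_power [of 21] by (simp add: J_def flip: power_mult)
  ultimately show ?thesis
    using dvd_card_partitions [of 11 6 "- {6}" 2 "J ^ 7" n] by simp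
qed

theorem theorem3:
  fixes n :: nat
  shows "Q 5 (5 * n + 4) mod 5 = 0 \<and> Q 7 (7 * n + 5) mod 7 = 0 \<and> Q 11 (11 * n + 6) mod 11 = 0"
  using dvd_Q [OF _ ramanujan_5] dvd_Q [OF _ ramanujan_7] dvd_Q [OF _ ramanujan_11]
  by (simp add: dvd_eq_mod_eq_0)

end
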